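(* For every $n\ge1$ and every non-constant function $f\colon\{0,1\}^n\to\{-1,1\}$ we have $\mathsf{D}_{\oplus}(f)\ge \mathsf{gran}(f)+1$.
   Context: For $S \subseteq [n]$ let $\chi_S(x)=\prod_{i\in S}(-1)^{x_i}$ and $\widehat{f}(S)=2^{-n}\sum_{x\in\{0,1\}^n} f(x)\chi_S(x)$. For a rational $\alpha$ whose denominator is a power of $2$, $\mathsf{gran}(\alpha)$ is the minimal integer $k\ge0$ with $2^k\alpha\in\mathbb{Z}$; $\mathsf{gran}(f)=\max_{S\subseteq[n]}\mathsf{gran}(\widehat{f}(S))$. A parity decision tree is a rooted binary tree whose internal nodes are labeled by parities $\bigoplus_{i\in S}x_i$ ($S\subseteq[n]$), with two outgoing edges per internal node labeled by the possible values of the parity, and leaves labeled by $-1$ or $1$; on input $x$ one follows the edges consistent with $x$ and outputs the leaf label. $\mathsf{D}_{\oplus}(f)$ is the minimal depth of a parity decision tree computing $f$ on all inputs. *)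

theory Defs
  imports Complex_Main "HOL-Library.FuncSet"
begin

definition cube :: "nat \<Rightarrow> (nat \<Rightarrow> nat) set" where
  "cube n = {1..n} \<rightarrow>\<^sub>E {0, 1}"

definition character :: "nat set \<Rightarrow> (nat \<Rightarrow> nat) \<Rightarrow> rat" where
  "character S x = (\<Prod>i\<in>S. (-1) ^ x i)"

definition fourier :: "nat \<Rightarrow> ((nat \<Rightarrow> nat) \<Rightarrow> rat) \<Rightarrow> nat set \<Rightarrow> rat" where
  "fourier n f S = (\<Sum>x\<in>cube n. f x * character S x) / 2 ^ n"

(* Meaningful only for rationals whose denominator is a power of 2; otherwise no k
   qualifies and the value is unspecified.  The Fourier coefficients of an integer-valued
   function on the n-cube always qualify, with k = n. *)
definition gran :: "rat \<Rightarrow> nat" where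
  "gran a = (LEAST k. 2 ^ k * a \<in> \<int>)"

definition gran_fun :: "nat \<Rightarrow> ((nat \<Rightarrow> nat) \<Rightarrow> rat) \<Rightarrow> nat" where
  "gran_fun n f = Max ((\<lambda>S. gran (fourier n f S)) ` Pow {1..n})"

(* In Query S t u, the edge labelled 0 leads to t and the edge labelled 1 leads to u. *)
datatype pdt = Leaf rat | Query "nat set" pdt pdt

primrec pdt_wf :: "nat \<Rightarrow> pdt \<Rightarrow> bool" where
  "pdt_wf n (Leaf b) \<longleftrightarrow> b \<in> {-1, 1}"
| "pdt_wf n (Query S t u) \<longleftrightarrow> S \<subseteq> {1..n} \<and> pdt_wf n t \<and> pdt_wf n u"

primrec pdt_output :: "pdt \<Rightarrow> (nat \<Rightarrow> nat) \<Rightarrow> rat" where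
  "pdt_output (Leaf b) x = b"
| "pdt_output (Query S t u) x =
     (if (\<Sum>i\<in>S. x i) mod 2 = 0 then pdt_output t x else pdt_output u x)"

primrec pdt_depth :: "pdt \<Rightarrow> nat" where
  "pdt_depth (Leaf b) = 0"
| "pdt_depth (Query S t u) = Suc (max (pdt_depth t) (pdt_depth u))"

definition pdt_computes :: "nat \<Rightarrow> pdt \<Rightarrow> ((nat \<Rightarrow> nat) \<Rightarrow> rat) \<Rightarrow> bool" where
  "pdt_computes n t f \<longleftrightarrow> pdt_wf n t \<and> (\<forall>x\<in>cube n. pdt_output t x = f x)"

definition parity_depth :: "nat \<Rightarrow> ((nat \<Rightarrow> nat) \<Rightarrow> rat) \<Rightarrow> nat" where
  "parity_depth n f = (LEAST d. \<exists>t. pdt_computes n t f \<and> pdt_depth t = d)"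

end

theory Submission
  imports Defs
begin

text \<open>
  If the root of a tree queries the parity of \<open>T\<close> and \<open>g\<close>, \<open>h\<close> are computed by its subtrees, then
  the tree computes \<open>(1 + \<chi>\<^sub>T)/2 * g + (1 - \<chi>\<^sub>T)/2 * h\<close>. Every Fourier coefficient of this
  function is half of a signed sum of coefficients of \<open>g\<close> and \<open>h\<close>, so each level of queries raises
  the granularity by at most one. The first level is free: a tree of depth one with leaves \<open>a\<close> and
  \<open>b\<close> has only the coefficients \<open>(a + b)/2\<close> and \<open>(a - b)/2\<close>, which are integers for signs \<open>a\<close>,
  \<open>b\<close>. A non-constant function needs at least one query, so depth \<open>d + 1\<close> gives granularity at
  most \<open>d\<close>.
\<close>

lemma finite_cube: "finite (cube n)"
  unfolding cube_def by (intro finite_PiE) auto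

lemma card_cube: "card (cube n) = 2 ^ n"
  unfolding cube_def by (simp add: card_PiE card_insert_if numeral_2_eq_2)

lemma cube_upd:
  assumes "x \<in> cube n" "a \<in> {1..n}" "b \<in> {0, 1}"
  shows "x(a := b) \<in> cube n"
  using assms unfolding cube_def by (auto simp: PiE_iff extensional_def)

lemma cube_app:
  assumes "x \<in> cube n" "a \<in> {1..n}"
  shows "x a \<in> {0, 1}"
  using assms unfolding cube_def by (blast dest: PiE_mem)

lemma character_eq: "character S x = (if even (\<Sum>i\<in>S. x i) then 1 else -1)"
  unfolding character_def power_sum[symmetric] by (rule minus_one_power_iff)

text \<open>Each index of \<open>S \<inter> T\<close> contributes a square of a sign, so only the
  symmetric difference survives.\<close>

lemma character_mult:
  assumes "finite S" "finite T"
  shows "character S x * character T x = character ((S - T) \<union> (T - S)) x"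
proof -
  have split: "character A x = character (A - B) x * character (A \<inter> B) x" if "finite A" for A B
    unfolding character_def
    using prod.Int_Diff[OF that, of "\<lambda>i. (-1) ^ x i" B] by (simp add: mult.commute)
  have sq: "character A x * character A x = 1" for A
    by (simp add: character_eq)
  have "character S x * character T x
      = character (S - T) x * character (T - S) x * (character (S \<inter> T) x * character (S \<inter> T) x)"
    using split[OF assms(1), of T] split[OF assms(2), of S] by (simp add: Int_commute mult_ac)
  also have "\<dots> = character (S - T) x * character (T - S) x"
    by (simp only: sq mult_1_right)
  also have "\<dots> = character ((S - T) \<union> (T - S)) x"
    unfolding character_def by (subst prod.union_disjoint) (use assms in auto)
  finally show ?thesis .
qed

text \<open>Exactly one factor changes sign. Subtraction on naturals truncates, so
  \<open>1 - x a\<close> is a bit flip only because \<open>x a\<close> is 0 or 1.\<close>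

lemma character_flip:
  assumes "finite S" "a \<in> S" "x a \<in> {0, 1}"
  shows "character S (x(a := 1 - x a)) = - character S x"
proof -
  have "(\<Prod>i\<in>S - {a}. (-1) ^ (x(a := 1 - x a)) i) = (\<Prod>i\<in>S - {a}. (-1 :: rat) ^ x i)"
    by (intro prod.cong) auto
  then show ?thesis
    using assms unfolding character_def by (auto simp: prod.remove)
qed

lemma sum_character:
  assumes "S \<subseteq> {1..n}"
  shows "(\<Sum>x\<in>cube n. character S x) = (if S = {} then 2 ^ n else 0)"
proof (cases "S = {}")
  case True
  then show ?thesis by (simp add: character_def card_cube)
next
  case False
  then obtain a where a: "a \<in> S" by blast
  then have an: "a \<in> {1..n}" and fin: "finite S"
    using assms finite_subset by auto
  \<comment> \<open>Flipping coordinate \<open>a\<close> is an involution of the cube that reverses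
    the sign of every term, so the sum equals its own negative.\<close>
  have "(\<Sum>x\<in>cube n. character S x) = (\<Sum>x\<in>cube n. - character S x)"
  proof (rule sum.reindex_bij_witness[where i = "\<lambda>x. x(a := 1 - x a)" and j = "\<lambda>x. x(a := 1 - x a)"])
    fix x assume x: "x \<in> cube n"
    have xa: "x a \<in> {0, 1}" by (rule cube_app[OF x an])
    then show "(x(a := 1 - x a))(a := 1 - (x(a := 1 - x a)) a) = x" by auto
    then show "(x(a := 1 - x a))(a := 1 - (x(a := 1 - x a)) a) = x" .
    show "x(a := 1 - x a) \<in> cube n" using cube_upd[OF x an] xa by auto
    then show "x(a := 1 - x a) \<in> cube n" .
    show "- character S (x(a := 1 - x a)) = character S x"
      using character_flip[OF fin a, of x] xa by simp
  qed
  then show ?thesis using False by (simp add: sum_negf)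
qed

lemma fourier_Leaf:
  assumes "S \<subseteq> {1..n}"
  shows "fourier n (pdt_output (Leaf b)) S = (if S = {} then b else 0)"
  using sum_character[OF assms] unfolding fourier_def by (simp flip: sum_distrib_left)

text \<open>Multiplying a function by \<open>character T\<close> moves its coefficient at
  \<open>D\<close> to \<open>S\<close>.\<close>

lemma fourier_Query:
  assumes "S \<subseteq> {1..n}" "T \<subseteq> {1..n}"
  defines "D \<equiv> (S - T) \<union> (T - S)"
  shows "2 * fourier n (pdt_output (Query T t u)) S
       = fourier n (pdt_output t) S + fourier n (pdt_output t) D
       + fourier n (pdt_output u) S - fourier n (pdt_output u) D"
proof -
  have fin: "finite S" "finite T" using assms finite_subset by auto
  \<comment> \<open>Since \<open>character D x\<close> is \<open>character S x\<close> times the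
    sign \<open>character T x\<close>, the two terms of the subtree that \<open>x\<close> does not
    enter cancel and those of the other agree.\<close>
  have "2 * (pdt_output (Query T t u) x * character S x)
      = pdt_output t x * character S x + pdt_output t x * character D x
      + pdt_output u x * character S x - pdt_output u x * character D x" for x
    using character_mult[OF fin, of x, symmetric] character_eq[of T x]
    unfolding D_def by (auto simp: even_iff_mod_2_eq_zero)
  then have "2 * (\<Sum>x\<in>cube n. pdt_output (Query T t u) x * character S x)
      = (\<Sum>x\<in>cube n. pdt_output t x * character S x) + (\<Sum>x\<in>cube n. pdt_output t x * character D x)
      + (\<Sum>x\<in>cube n. pdt_output u x * character S x) - (\<Sum>x\<in>cube n. pdt_output u x * character D x)"
    by (simp only: sum_distrib_left sum.distrib sum_subtractf)
  then show ?thesis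
    unfolding fourier_def
    by (simp only: times_divide_eq_right flip: add_divide_distrib diff_divide_distrib)
qed

text \<open>Induction on \<open>d\<close>, with depth only bounded above so that unbalanced subtrees
  are covered. The base case contains all trees of depth at most one.\<close>

lemma fourier_pdt_Ints:
  assumes "pdt_wf n t" "pdt_depth t \<le> Suc d" "S \<subseteq> {1..n}"
  shows "2 ^ d * fourier n (pdt_output t) S \<in> \<int>"
  using assms
proof (induction d arbitrary: t S)
  case 0
  show ?case
  proof (cases t)
    case (Leaf b)
    with 0 show ?thesis unfolding Leaf fourier_Leaf[OF 0(3)] by auto
  next
    case (Query T t1 t2)
    with 0 obtain a b where leaves: "t1 = Leaf a" "t2 = Leaf b"
      by (cases t1; cases t2) auto
    have ab: "a \<in> {-1, 1}" "b \<in> {-1, 1}" and T: "T \<subseteq> {1..n}"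
      using 0 Query leaves by auto
    let ?D = "(S - T) \<union> (T - S)"
    have D: "?D \<subseteq> {1..n}" "?D = {} \<longleftrightarrow> S = T" using T 0 by auto
    have "2 * fourier n (pdt_output t) S
        = (if S = {} then a + b else 0) + (if S = T then a - b else 0)"
      unfolding Query leaves fourier_Query[OF 0(3) T] fourier_Leaf[OF 0(3)] fourier_Leaf[OF D(1)] D(2)
      by simp
    then have "fourier n (pdt_output t) S
        = (if S = {} then (a + b) / 2 else 0) + (if S = T then (a - b) / 2 else 0)"
      by (simp add: field_simps split: if_splits)
    \<comment> \<open>Two signs have an even sum and an even difference, so both halves are
      integers.\<close>
    then show ?thesis using ab by auto
  qed
next
  case (Suc d)
  show ?case
  proof (cases t)
    case (Leaf b)
    with Suc.prems show ?thesis unfolding Leaf fourier_Leaf[OF Suc.prems(3)] by auto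
  next
    case (Query T t1 t2)
    let ?D = "(S - T) \<union> (T - S)"
    have T: "T \<subseteq> {1..n}" and D: "?D \<subseteq> {1..n}" using Suc.prems Query by auto
    have ih: "2 ^ d * fourier n (pdt_output t') A \<in> \<int>"
      if "t' \<in> {t1, t2}" "A \<subseteq> {1..n}" for t' A
      using that Suc.prems Query by (intro Suc.IH) auto
    \<comment> \<open>The extra factor 2 is spent on the halving in
      \<open>fourier_Query\<close>.\<close>
    have "2 ^ Suc d * fourier n (pdt_output t) S
        = 2 ^ d * (2 * fourier n (pdt_output t) S)" by simp
    also have "\<dots> = 2 ^ d * fourier n (pdt_output t1) S + 2 ^ d * fourier n (pdt_output t1) ?D
        + 2 ^ d * fourier n (pdt_output t2) S - 2 ^ d * fourier n (pdt_output t2) ?D"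
      unfolding Query fourier_Query[OF Suc.prems(3) T] by (simp only: distrib_left right_diff_distrib)
    also have "\<dots> \<in> \<int>"
      using ih Suc.prems(3) D by (intro Ints_add Ints_diff) auto
    finally show ?thesis .
  qed
qed

lemma gran_fun_le:
  assumes "\<And>S. S \<subseteq> {1..n} \<Longrightarrow> 2 ^ d * fourier n f S \<in> \<int>"
  shows "gran_fun n f \<le> d"
  unfolding gran_fun_def
proof (rule Max.boundedI)
  fix k assume "k \<in> (\<lambda>S. gran (fourier n f S)) ` Pow {1..n}"
  then show "k \<le> d" using assms unfolding gran_def by (auto intro: Least_le)
qed auto

text \<open>Induction on the set \<open>A\<close> of coordinates that determine \<open>f\<close>:
  query one of them and recurse on the two restrictions.\<close>

lemma ex_pdt_junta:
  assumes "A \<subseteq> {1..n}" "f \<in> cube n \<rightarrow> {-1, 1}"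
    and "\<And>x y. x \<in> cube n \<Longrightarrow> y \<in> cube n \<Longrightarrow> \<forall>i\<in>A. x i = y i \<Longrightarrow> f x = f y"
  shows "\<exists>t. pdt_computes n t f"
proof -
  have "finite A" using assms(1) finite_subset by auto
  then show ?thesis using assms
  proof (induction A arbitrary: f rule: finite_induct)
    case empty
    obtain z where z: "z \<in> cube n" using card_cube[of n] by (cases "cube n = {}") auto
    have "\<forall>x\<in>cube n. f z = f x" using empty.prems(3)[OF z] by blast
    moreover have "f z \<in> {-1, 1}" using empty.prems(2) z by blast
    ultimately have "pdt_computes n (Leaf (f z)) f"
      unfolding pdt_computes_def by simp
    then show ?case ..
  next
    case (insert a A)
    have a: "a \<in> {1..n}" using insert.prems(1) by blast
    \<comment> \<open>Once coordinate \<open>a\<close> is overwritten by \<open>b\<close>, the value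
      depends on the coordinates in \<open>A\<close> only.\<close>
    have "\<exists>t. pdt_computes n t (\<lambda>x. f (x(a := b)))" if b: "b \<in> {0, 1}" for b
    proof (rule insert.IH)
      show "A \<subseteq> {1..n}" using insert.prems(1) by blast
      show "(\<lambda>x. f (x(a := b))) \<in> cube n \<rightarrow> {-1, 1}"
        using insert.prems(2) cube_upd[OF _ a b] by auto
      show "f (x(a := b)) = f (y(a := b))"
        if "x \<in> cube n" "y \<in> cube n" "\<forall>i\<in>A. x i = y i" for x y
        using that by (intro insert.prems(3) cube_upd[OF _ a b]) auto
    qed
    from this[of 0] this[of 1] obtain t u where
      t: "pdt_computes n t (\<lambda>x. f (x(a := 0)))" and u: "pdt_computes n u (\<lambda>x. f (x(a := 1)))"
      by auto
    have "pdt_output (Query {a} t u) x = f x" if x: "x \<in> cube n" for x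
    proof (cases "x a = 0")
      case True
      then have "x(a := 0) = x" by auto
      with t x True show ?thesis unfolding pdt_computes_def by auto
    next
      case False
      then have "x a = 1" using cube_app[OF x a] by auto
      moreover from this have "x(a := 1) = x" by auto
      ultimately show ?thesis using u x unfolding pdt_computes_def by auto
    qed
    then have "pdt_computes n (Query {a} t u) f"
      using t u a unfolding pdt_computes_def by auto
    then show ?case ..
  qed
qed

lemma ex_pdt_computes:
  assumes "f \<in> cube n \<rightarrow> {-1, 1}"
  shows "\<exists>t. pdt_computes n t f"
proof (rule ex_pdt_junta[OF subset_refl assms])
  fix x y assume "x \<in> cube n" "y \<in> cube n" "\<forall>i\<in>{1..n}. x i = y i"
  then have "x = y" unfolding cube_def by (intro PiE_ext) auto
  then show "f x = f y" by simp
qed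

theorem theorem6:
  fixes n :: nat and f :: "(nat \<Rightarrow> nat) \<Rightarrow> rat"
  assumes "n \<ge> 1"
    and "f \<in> cube n \<rightarrow> {-1, 1}"
    and "\<not> (\<exists>c. \<forall>x\<in>cube n. f x = c)"
  shows "parity_depth n f \<ge> gran_fun n f + 1"
proof -
  \<comment> \<open>The \<open>LEAST\<close> in \<open>parity_depth\<close> is attained because some
    tree computes \<open>f\<close>.\<close>
  have "\<exists>t. pdt_computes n t f \<and> pdt_depth t = parity_depth n f"
    unfolding parity_depth_def by (rule LeastI_ex) (use ex_pdt_computes[OF assms(2)] in blast)
  then obtain t where t: "pdt_wf n t" "\<And>x. x \<in> cube n \<Longrightarrow> pdt_output t x = f x"
    and depth: "pdt_depth t = parity_depth n f"
    unfolding pdt_computes_def by blast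
  \<comment> \<open>A single leaf would make \<open>f\<close> constant on the cube.\<close>
  have "pdt_depth t \<noteq> 0"
  proof
    assume "pdt_depth t = 0"
    then obtain b where "t = Leaf b" by (cases t) auto
    with t(2) have "\<forall>x\<in>cube n. f x = b" by auto
    with assms(3) show False by blast
  qed
  then obtain d where d: "pdt_depth t = Suc d" using not0_implies_Suc by blast
  have "gran_fun n f \<le> d"
  proof (rule gran_fun_le)
    fix S assume "S \<subseteq> {1..n}"
    then have "2 ^ d * fourier n (pdt_output t) S \<in> \<int>"
      using fourier_pdt_Ints t(1) d by simp
    moreover have "fourier n (pdt_output t) S = fourier n f S"
      unfolding fourier_def using t(2) by simp
    ultimately show "2 ^ d * fourier n f S \<in> \<int>" by simp
  qed
  then show ?thesis using d depth by simp
qed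

end
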